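(* Let $C$ be a co-Frobenius coalgebra over a field $k$, let $\alpha:C\to C^*$ be an injective morphism of left $C^*$-modules, and let $\beta:C\to C^*$ be the associated injective morphism of right $C^*$-modules given by $\beta(x)(y)=\alpha(y)(x)$. Let $\circ$ and $\odot$ be the multiplications on $C$ obtained by transferring the multiplication of $\mathrm{Rat}(C^* )$ through $\alpha$ and $\beta$, that is $x\circ y=\alpha^{-1}(\alpha(x)\alpha(y))$ and $x\odot y=\beta^{-1}(\beta(x)\beta(y))$. Then $x\circ y=x\odot y$ for all $x,y\in C$.
   Context: For a coalgebra $C$ over $k$ with $\Delta(x)=\sum x_1\otimes x_2$, the dual $C^*$ is an algebra with the convolution product $(c^*d^* )(x)=\sum c^*(x_1)d^*(x_2)$. $C$ is a $(C^*,C^* )$-bimodule with $c^*\cdot x=\sum c^*(x_2)x_1$ and $x\cdot c^*=\sum c^*(x_1)x_2$; $C^*$ is a bimodule over itself by multiplication. $C$ is left (respectively right) co-Frobenius if there is an injective morphism of left (respectively right) $C^*$-modules $C\to C^*$; co-Frobenius means left and right co-Frobenius. The rational part of a left (respectively right) $C^*$-module is its largest submodule whose module structure is induced by a right (respectively left) $C$-comodule structure. For a co-Frobenius coalgebra the rational parts of $C^*$ as a left and as a right $C^*$-module coincide; this common subspace is denoted $\mathrm{Rat}(C^* )$. It is a subring (without identity in general) of $C^*$. For a co-Frobenius coalgebra $C$, any injective morphism of left (or right) $C^*$-modules $C\to C^*$ has image exactly $\mathrm{Rat}(C^* )$, and for $\alpha$ as in the claim, $\beta$ is an injective morphism of right $C^*$-modules;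 $\alpha^{-1},\beta^{-1}:\mathrm{Rat}(C^* )\to C$ denote the inverses of the induced bijections $C\to\mathrm{Rat}(C^* )$. *)

theory Defs
  imports Complex_Main "HOL-Library.Poly_Mapping" "HOL-Library.Function_Algebras"
    "HOL-Library.FuncSet"
begin

section \<open>Tensor products\<close>

text \<open>
  The tensor product of subspaces V and W is the free vector space on the pairs in V and W modulo
  the span of the bilinearity relations; likewise for three factors. Its elements are written as
  finite sums of pure tensors: a list \<open>[(v1, w1), ..., (vn, wn)]\<close> denotes
  \<open>v1 \<otimes> w1 + ... + vn \<otimes> wn\<close>. Every element has such a form, as scalars can be absorbed into a
  factor. Lists are only representatives; equality in the tensor product is \<open>tensor_eq\<close>
  (and \<open>tensor3_eq\<close>).
\<close>

definition free_scale :: "'k::field \<Rightarrow> ('g \<Rightarrow>\<^sub>0 'k) \<Rightarrow> ('g \<Rightarrow>\<^sub>0 'k)" where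
  "free_scale a f = Poly_Mapping.map ((*) a) f"

definition free_gen :: "'g \<Rightarrow> ('g \<Rightarrow>\<^sub>0 'k::field)" where
  "free_gen g = Poly_Mapping.single g 1"

definition formal_sum :: "'g list \<Rightarrow> ('g \<Rightarrow>\<^sub>0 'k::field)" where
  "formal_sum t = (\<Sum>g\<leftarrow>t. free_gen g)"

text \<open>Linearity in one factor: \<open>ins v\<close> is the pure tensor with \<open>v\<close> in the factor considered, the
  other factors being fixed.\<close>

definition slot_relations ::
  "('k::field \<Rightarrow> 'v::ab_group_add \<Rightarrow> 'v) \<Rightarrow> 'v set \<Rightarrow> ('v \<Rightarrow> 'g) \<Rightarrow> ('g \<Rightarrow>\<^sub>0 'k) set" where
  "slot_relations s V ins =
     {free_gen (ins (v + v')) - free_gen (ins v) - free_gen (ins v') | v v'. v \<in> V \<and> v' \<in> V} \<union>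
     {free_gen (ins (s a v)) - free_scale a (free_gen (ins v)) | a v. v \<in> V}"

definition tensor_eq ::
  "('k::field \<Rightarrow> 'v::ab_group_add \<Rightarrow> 'v) \<Rightarrow> 'v set \<Rightarrow>
   ('k \<Rightarrow> 'w::ab_group_add \<Rightarrow> 'w) \<Rightarrow> 'w set \<Rightarrow> ('v \<times> 'w) list \<Rightarrow> ('v \<times> 'w) list \<Rightarrow> bool" where
  "tensor_eq s V s' W t t' \<longleftrightarrow>
     formal_sum t - formal_sum t' \<in> module.span free_scale
       ((\<Union>w\<in>W. slot_relations s V (\<lambda>v. (v, w))) \<union>
        (\<Union>v\<in>V. slot_relations s' W (\<lambda>w. (v, w))))"

definition tensor3_eq ::
  "('k::field \<Rightarrow> 'u::ab_group_add \<Rightarrow> 'u) \<Rightarrow> 'u set \<Rightarrow>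
   ('k \<Rightarrow> 'v::ab_group_add \<Rightarrow> 'v) \<Rightarrow> 'v set \<Rightarrow>
   ('k \<Rightarrow> 'w::ab_group_add \<Rightarrow> 'w) \<Rightarrow> 'w set \<Rightarrow>
   ('u \<times> 'v \<times> 'w) list \<Rightarrow> ('u \<times> 'v \<times> 'w) list \<Rightarrow> bool" where
  "tensor3_eq s U s' V s'' W t t' \<longleftrightarrow>
     formal_sum t - formal_sum t' \<in> module.span free_scale
       ((\<Union>v\<in>V. \<Union>w\<in>W. slot_relations s U (\<lambda>u. (u, v, w))) \<union>
        (\<Union>u\<in>U. \<Union>w\<in>W. slot_relations s' V (\<lambda>v. (u, v, w))) \<union>
        (\<Union>u\<in>U. \<Union>v\<in>V. slot_relations s'' W (\<lambda>w. (u, v, w))))"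


section \<open>Coalgebras\<close>

text \<open>
  The list \<open>\<Delta> x\<close> is a representative of the comultiplication of \<open>x\<close>, that is, a choice of the
  summands in \<open>\<Sum> x1 \<otimes> x2\<close>. The map itself, from C to \<open>C \<otimes> C\<close>, is only required to be linear
  and coassociative as a map into the tensor product.
\<close>

locale coalgebra = vector_space scale
  for scale :: "'k::field \<Rightarrow> 'c::ab_group_add \<Rightarrow> 'c" +
  fixes \<Delta> :: "'c \<Rightarrow> ('c \<times> 'c) list"
    and \<epsilon> :: "'c \<Rightarrow> 'k"
  assumes comult_add:
      "tensor_eq scale UNIV scale UNIV (\<Delta> (x + y)) (\<Delta> x @ \<Delta> y)"
    and comult_scale:
      "tensor_eq scale UNIV scale UNIV (\<Delta> (scale a x)) (map (\<lambda>(x1, x2). (scale a x1, x2)) (\<Delta> x))"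
    and counit_linear: "Vector_Spaces.linear scale (*) \<epsilon>"
    and coassoc:
      "tensor3_eq scale UNIV scale UNIV scale UNIV
         [(x11, x12, x2). (x1, x2) \<leftarrow> \<Delta> x, (x11, x12) \<leftarrow> \<Delta> x1]
         [(x1, x21, x22). (x1, x2) \<leftarrow> \<Delta> x, (x21, x22) \<leftarrow> \<Delta> x2]"
    and counit_left: "(\<Sum>(x1, x2)\<leftarrow>\<Delta> x. scale (\<epsilon> x1) x2) = x"
    and counit_right: "(\<Sum>(x1, x2)\<leftarrow>\<Delta> x. scale (\<epsilon> x2) x1) = x"


section \<open>The dual algebra and its actions\<close>

definition dual :: "('k::field \<Rightarrow> 'c::ab_group_add \<Rightarrow> 'c) \<Rightarrow> ('c \<Rightarrow> 'k) set" where
  "dual scale = {f. Vector_Spaces.linear scale (*) f}"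

definition fun_scale :: "'k::field \<Rightarrow> ('c \<Rightarrow> 'k) \<Rightarrow> ('c \<Rightarrow> 'k)" where
  "fun_scale a f = (\<lambda>x. a * f x)"

definition convolution ::
  "('c \<Rightarrow> ('c \<times> 'c) list) \<Rightarrow> ('c \<Rightarrow> 'k::field) \<Rightarrow> ('c \<Rightarrow> 'k) \<Rightarrow> ('c \<Rightarrow> 'k)" where
  "convolution \<Delta> f g = (\<lambda>x. \<Sum>(x1, x2)\<leftarrow>\<Delta> x. f x1 * g x2)"

definition left_act ::
  "('k::field \<Rightarrow> 'c::ab_group_add \<Rightarrow> 'c) \<Rightarrow> ('c \<Rightarrow> ('c \<times> 'c) list) \<Rightarrow> ('c \<Rightarrow> 'k) \<Rightarrow> 'c \<Rightarrow> 'c" where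
  "left_act scale \<Delta> f x = (\<Sum>(x1, x2)\<leftarrow>\<Delta> x. scale (f x2) x1)"

definition right_act ::
  "('k::field \<Rightarrow> 'c::ab_group_add \<Rightarrow> 'c) \<Rightarrow> ('c \<Rightarrow> ('c \<times> 'c) list) \<Rightarrow> 'c \<Rightarrow> ('c \<Rightarrow> 'k) \<Rightarrow> 'c" where
  "right_act scale \<Delta> x f = (\<Sum>(x1, x2)\<leftarrow>\<Delta> x. scale (f x1) x2)"

definition left_dual_morphism ::
  "('k::field \<Rightarrow> 'c::ab_group_add \<Rightarrow> 'c) \<Rightarrow> ('c \<Rightarrow> ('c \<times> 'c) list) \<Rightarrow> ('c \<Rightarrow> 'c \<Rightarrow> 'k) \<Rightarrow> bool" where
  "left_dual_morphism scale \<Delta> \<phi> \<longleftrightarrow>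
     (\<forall>x. \<phi> x \<in> dual scale) \<and> (\<forall>x y. \<phi> (x + y) = \<phi> x + \<phi> y) \<and>
     (\<forall>f\<in>dual scale. \<forall>x. \<phi> (left_act scale \<Delta> f x) = convolution \<Delta> f (\<phi> x))"

definition right_dual_morphism ::
  "('k::field \<Rightarrow> 'c::ab_group_add \<Rightarrow> 'c) \<Rightarrow> ('c \<Rightarrow> ('c \<times> 'c) list) \<Rightarrow> ('c \<Rightarrow> 'c \<Rightarrow> 'k) \<Rightarrow> bool" where
  "right_dual_morphism scale \<Delta> \<phi> \<longleftrightarrow>
     (\<forall>x. \<phi> x \<in> dual scale) \<and> (\<forall>x y. \<phi> (x + y) = \<phi> x + \<phi> y) \<and>
     (\<forall>f\<in>dual scale. \<forall>x. \<phi> (right_act scale \<Delta> x f) = convolution \<Delta> (\<phi> x) f)"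

definition left_co_frobenius ::
  "('k::field \<Rightarrow> 'c::ab_group_add \<Rightarrow> 'c) \<Rightarrow> ('c \<Rightarrow> ('c \<times> 'c) list) \<Rightarrow> bool" where
  "left_co_frobenius scale \<Delta> \<longleftrightarrow> (\<exists>\<phi>. left_dual_morphism scale \<Delta> \<phi> \<and> inj \<phi>)"

definition right_co_frobenius ::
  "('k::field \<Rightarrow> 'c::ab_group_add \<Rightarrow> 'c) \<Rightarrow> ('c \<Rightarrow> ('c \<times> 'c) list) \<Rightarrow> bool" where
  "right_co_frobenius scale \<Delta> \<longleftrightarrow> (\<exists>\<phi>. right_dual_morphism scale \<Delta> \<phi> \<and> inj \<phi>)"

definition co_frobenius ::
  "('k::field \<Rightarrow> 'c::ab_group_add \<Rightarrow> 'c) \<Rightarrow> ('c \<Rightarrow> ('c \<times> 'c) list) \<Rightarrow> bool" where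
  "co_frobenius scale \<Delta> \<longleftrightarrow> left_co_frobenius scale \<Delta> \<and> right_co_frobenius scale \<Delta>"


section \<open>Comodules and rational parts\<close>

text \<open>As for \<open>\<Delta>\<close>, the list \<open>\<rho> m\<close> represents an element of \<open>M \<otimes> C\<close> (respectively \<open>C \<otimes> M\<close>).\<close>

definition right_comodule ::
  "('k::field \<Rightarrow> 'c::ab_group_add \<Rightarrow> 'c) \<Rightarrow> ('c \<Rightarrow> ('c \<times> 'c) list) \<Rightarrow> ('c \<Rightarrow> 'k) \<Rightarrow>
   ('k \<Rightarrow> 'm::ab_group_add \<Rightarrow> 'm) \<Rightarrow> 'm set \<Rightarrow> ('m \<Rightarrow> ('m \<times> 'c) list) \<Rightarrow> bool" where
  "right_comodule scale \<Delta> \<epsilon> s M \<rho> \<longleftrightarrow>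
     vector_space s \<and> module.subspace s M \<and>
     (\<forall>m\<in>M. set (\<rho> m) \<subseteq> M \<times> UNIV) \<and>
     (\<forall>m\<in>M. \<forall>m'\<in>M. tensor_eq s M scale UNIV (\<rho> (m + m')) (\<rho> m @ \<rho> m')) \<and>
     (\<forall>a. \<forall>m\<in>M. tensor_eq s M scale UNIV (\<rho> (s a m)) (map (\<lambda>(m0, m1). (s a m0, m1)) (\<rho> m))) \<and>
     (\<forall>m\<in>M. tensor3_eq s M scale UNIV scale UNIV
        [(m00, m01, m1). (m0, m1) \<leftarrow> \<rho> m, (m00, m01) \<leftarrow> \<rho> m0]
        [(m0, m11, m12). (m0, m1) \<leftarrow> \<rho> m, (m11, m12) \<leftarrow> \<Delta> m1]) \<and>
     (\<forall>m\<in>M. (\<Sum>(m0, m1)\<leftarrow>\<rho> m. s (\<epsilon> m1) m0) = m)"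

definition left_comodule ::
  "('k::field \<Rightarrow> 'c::ab_group_add \<Rightarrow> 'c) \<Rightarrow> ('c \<Rightarrow> ('c \<times> 'c) list) \<Rightarrow> ('c \<Rightarrow> 'k) \<Rightarrow>
   ('k \<Rightarrow> 'm::ab_group_add \<Rightarrow> 'm) \<Rightarrow> 'm set \<Rightarrow> ('m \<Rightarrow> ('c \<times> 'm) list) \<Rightarrow> bool" where
  "left_comodule scale \<Delta> \<epsilon> s M \<rho> \<longleftrightarrow>
     vector_space s \<and> module.subspace s M \<and>
     (\<forall>m\<in>M. set (\<rho> m) \<subseteq> UNIV \<times> M) \<and>
     (\<forall>m\<in>M. \<forall>m'\<in>M. tensor_eq scale UNIV s M (\<rho> (m + m')) (\<rho> m @ \<rho> m')) \<and>
     (\<forall>a. \<forall>m\<in>M. tensor_eq scale UNIV s M (\<rho> (s a m)) (map (\<lambda>(m1, m0). (m1, s a m0)) (\<rho> m))) \<and>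
     (\<forall>m\<in>M. tensor3_eq scale UNIV scale UNIV s M
        [(m1, m01, m00). (m1, m0) \<leftarrow> \<rho> m, (m01, m00) \<leftarrow> \<rho> m0]
        [(m11, m12, m0). (m1, m0) \<leftarrow> \<rho> m, (m11, m12) \<leftarrow> \<Delta> m1]) \<and>
     (\<forall>m\<in>M. (\<Sum>(m1, m0)\<leftarrow>\<rho> m. s (\<epsilon> m1) m0) = m)"

definition left_rational_submodule ::
  "('k::field \<Rightarrow> 'c::ab_group_add \<Rightarrow> 'c) \<Rightarrow> ('c \<Rightarrow> ('c \<times> 'c) list) \<Rightarrow> ('c \<Rightarrow> 'k) \<Rightarrow>
   ('c \<Rightarrow> 'k) set \<Rightarrow> bool" where
  "left_rational_submodule scale \<Delta> \<epsilon> M \<longleftrightarrow>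
     M \<subseteq> dual scale \<and> module.subspace fun_scale M \<and>
     (\<forall>f\<in>dual scale. \<forall>m\<in>M. convolution \<Delta> f m \<in> M) \<and>
     (\<exists>\<rho>. right_comodule scale \<Delta> \<epsilon> fun_scale M \<rho> \<and>
        (\<forall>f\<in>dual scale. \<forall>m\<in>M.
           convolution \<Delta> f m = (\<Sum>(m0, m1)\<leftarrow>\<rho> m. fun_scale (f m1) m0)))"

definition right_rational_submodule ::
  "('k::field \<Rightarrow> 'c::ab_group_add \<Rightarrow> 'c) \<Rightarrow> ('c \<Rightarrow> ('c \<times> 'c) list) \<Rightarrow> ('c \<Rightarrow> 'k) \<Rightarrow>
   ('c \<Rightarrow> 'k) set \<Rightarrow> bool" where
  "right_rational_submodule scale \<Delta> \<epsilon> M \<longleftrightarrow>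
     M \<subseteq> dual scale \<and> module.subspace fun_scale M \<and>
     (\<forall>f\<in>dual scale. \<forall>m\<in>M. convolution \<Delta> m f \<in> M) \<and>
     (\<exists>\<rho>. left_comodule scale \<Delta> \<epsilon> fun_scale M \<rho> \<and>
        (\<forall>f\<in>dual scale. \<forall>m\<in>M.
           convolution \<Delta> m f = (\<Sum>(m1, m0)\<leftarrow>\<rho> m. fun_scale (f m1) m0)))"

definition left_rational_part ::
  "('k::field \<Rightarrow> 'c::ab_group_add \<Rightarrow> 'c) \<Rightarrow> ('c \<Rightarrow> ('c \<times> 'c) list) \<Rightarrow> ('c \<Rightarrow> 'k) \<Rightarrow>
   ('c \<Rightarrow> 'k) set" where
  "left_rational_part scale \<Delta> \<epsilon> = (GREATEST M. left_rational_submodule scale \<Delta> \<epsilon> M)"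

definition right_rational_part ::
  "('k::field \<Rightarrow> 'c::ab_group_add \<Rightarrow> 'c) \<Rightarrow> ('c \<Rightarrow> ('c \<times> 'c) list) \<Rightarrow> ('c \<Rightarrow> 'k) \<Rightarrow>
   ('c \<Rightarrow> 'k) set" where
  "right_rational_part scale \<Delta> \<epsilon> = (GREATEST M. right_rational_submodule scale \<Delta> \<epsilon> M)"

text \<open>The common value of the two rational parts; meaningful only when they coincide, which is the
  case for co-Frobenius coalgebras.\<close>

definition Rat ::
  "('k::field \<Rightarrow> 'c::ab_group_add \<Rightarrow> 'c) \<Rightarrow> ('c \<Rightarrow> ('c \<times> 'c) list) \<Rightarrow> ('c \<Rightarrow> 'k) \<Rightarrow>
   ('c \<Rightarrow> 'k) set" where
  "Rat scale \<Delta> \<epsilon> =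
     (THE R. R = left_rational_part scale \<Delta> \<epsilon> \<and> R = right_rational_part scale \<Delta> \<epsilon>)"

text \<open>The inverse of the bijection from C to \<open>R\<close> induced by \<open>\<phi>\<close>, as a function on \<open>R\<close> only.\<close>

definition inverse_on :: "('c \<Rightarrow> 'k) set \<Rightarrow> ('c \<Rightarrow> 'c \<Rightarrow> 'k::field) \<Rightarrow> ('c \<Rightarrow> 'k) \<Rightarrow> 'c" where
  "inverse_on R \<phi> = (\<lambda>r\<in>R. inv \<phi> r)"

definition transferred_mult ::
  "('c \<Rightarrow> ('c \<times> 'c) list) \<Rightarrow> ('c \<Rightarrow> 'k::field) set \<Rightarrow> ('c \<Rightarrow> 'c \<Rightarrow> 'k) \<Rightarrow> 'c \<Rightarrow> 'c \<Rightarrow> 'c" where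
  "transferred_mult \<Delta> R \<phi> x y = inverse_on R \<phi> (convolution \<Delta> (\<phi> x) (\<phi> y))"

end

theory Submission imports Defs begin

text \<open>
  Write \<open>B(x, y) = \<alpha> x y\<close>. For \<open>f\<close> in the dual algebra \<open>C*\<close>, let \<open>L\<^sub>f x = f \<cdot> x\<close> and
  \<open>T\<^sub>f y = y \<cdot> f\<close>. That \<open>\<alpha>\<close> is a morphism of left modules means exactly that \<open>L\<^sub>f\<close> and \<open>T\<^sub>f\<close> are
  adjoint, \<open>B(L\<^sub>f x, y) = B(x, T\<^sub>f y)\<close>; injectivity of \<open>\<alpha>\<close> means that \<open>B\<close> is nondegenerate on the
  left. The transpose \<open>\<beta>\<close> is then automatically a morphism of right modules.

  The identity behind the theorem is \<open>\<alpha>(x) \<cdot> y = x \<cdot> \<beta>(y)\<close> (\<open>left_right_act_eq\<close>): a functional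
  \<open>\<phi>\<close> takes on both sides the value \<open>\<alpha>(\<phi> \<cdot> x)(y)\<close>. Since \<open>\<alpha>(x) \<alpha>(y) = \<alpha>(\<alpha>(x) \<cdot> y)\<close> and
  \<open>\<beta>(x) \<beta>(y) = \<beta>(x \<cdot> \<beta>(y))\<close>, the two sides are the two transferred products, provided
  that \<open>\<beta>\<close> is injective and that \<open>\<alpha>\<close> and \<open>\<beta>\<close> both have image \<open>Rat(C*)\<close>.

  Both provisos come from one fact of linear algebra (\<open>adjoint_rank\<close>). If \<open>T\<close> has finite rank and
  \<open>L\<close> is adjoint to \<open>T\<close> under a form that is nondegenerate on the left, then the form embeds the
  image of \<open>L\<close> into the dual of the image of \<open>T\<close>; hence rank \<open>L \<le>\<close> rank \<open>T\<close>, and in case of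
  equality every functional on the image of \<open>T\<close> comes from the image of \<open>L\<close>. Over a co-Frobenius
  coalgebra, apply this with \<open>\<alpha>\<close> to \<open>L\<^sub>e\<close> and \<open>T\<^sub>e\<close>, and with an injective morphism of
  right modules to \<open>T\<^sub>e\<close> and \<open>L\<^sub>e\<close>: the two operators have the same rank, finite or infinite
  together. If it is finite, the functional \<open>\<epsilon>\<close> on the image of \<open>T\<^sub>e\<close> is represented by some \<open>p\<close>,
  that is \<open>\<alpha> p y = \<epsilon>(y \<cdot> e) = e y\<close>, so that \<open>e = \<alpha> p\<close>. Conversely \<open>L\<^sub>m\<close> has finite rank for
  each \<open>m\<close> in a rational left submodule, and the image of \<open>\<alpha>\<close> is such a submodule, because \<open>\<Delta>\<close> can be
  transported along \<open>\<alpha>\<close>. So the rational part on the left is the image of \<open>\<alpha>\<close>, and it consists of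
  the \<open>e\<close> for which \<open>L\<^sub>e\<close>, equivalently \<open>T\<^sub>e\<close>, has finite rank.

  By the identity above \<open>T\<^bsub>\<beta>(y)\<^esub>\<close> has finite rank, so the image of \<open>\<beta>\<close> lies in that of \<open>\<alpha>\<close>. If
  \<open>\<beta>(x) = \<beta>(y)\<close>, then all elements of the image of \<open>\<alpha>\<close>, hence all \<open>\<beta>(z)\<close>, agree at \<open>x\<close>
  and \<open>y\<close>, which says \<open>\<alpha>(x) = \<alpha>(y)\<close>. So \<open>\<beta>\<close> is injective, and the results on \<open>\<alpha>\<close>, applied to
  \<open>\<beta>\<close> over the opposite coalgebra, identify the rational part on the right with the image of \<open>\<beta>\<close>.
\<close>

section \<open>Adjoint operators of finite rank\<close>

lemma vector_space_field: "vector_space ((*) :: 'k::field \<Rightarrow> 'k \<Rightarrow> 'k)"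
  by unfold_locales (auto simp: algebra_simps)

lemma (in vector_space) functional_separates_span:
  assumes "x \<notin> span S"
  obtains L where "Vector_Spaces.linear scale (*) L" "\<And>y. y \<in> S \<Longrightarrow> L y = 0" "L x = 1"
proof -
  interpret dom_field: vector_space_pair scale "(*) :: 'a \<Rightarrow> 'a \<Rightarrow> 'a"
    by (intro vector_space_pair.intro vector_space_axioms vector_space_field)
  obtain B where B: "B \<subseteq> S" "independent B" "S \<subseteq> span B"
    using maximal_independent_subset[of S] by blast
  have x: "x \<notin> span B" using assms span_mono[OF B(1)] by blast
  obtain L where L: "Vector_Spaces.linear scale (*) L"
      "\<forall>y\<in>insert x B. L y = (if y = x then 1 else 0)"
    using dom_field.linear_independent_extend[OF independent_insertI[OF x B(2)],
        of "\<lambda>y. if y = x then 1 else 0"] by blast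
  have "L y = 0" if "y \<in> B" for y
    using L(2) that x span_base[of y B] by auto
  then have "L y = 0" if "y \<in> S" for y
    using dom_field.linear_eq_0_on_span[OF L(1), of B y] that B(3) by blast
  then show thesis using that L by simp
qed

lemma (in vector_space) functionals_separate_points:
  assumes "\<And>\<phi>. Vector_Spaces.linear scale (*) \<phi> \<Longrightarrow> \<phi> x = \<phi> y"
  shows "x = y"
proof (rule ccontr)
  assume "x \<noteq> y"
  then have "x - y \<notin> span {}" by simp
  then obtain L where L: "Vector_Spaces.linear scale (*) L" "L (x - y) = 1"
    by (rule functional_separates_span) auto
  interpret L: Vector_Spaces.linear scale "(*)" L by (rule L(1))
  show False using L(2) assms[OF L(1)] by (simp add: L.diff)
qed

definition (in vector_space) finite_rank :: "('b \<Rightarrow> 'b) \<Rightarrow> bool" where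
  "finite_rank F \<longleftrightarrow> (\<exists>W. finite W \<and> range F \<subseteq> span W)"

text \<open>The form embeds the image of \<open>L\<close> into the dual of the image of \<open>T\<close>: by adjointness \<open>b (L x)\<close>
  is determined by the restriction of \<open>b x\<close> to the image of \<open>T\<close>. If the dimensions agree, the embedding is
  onto.\<close>
lemma (in vector_space) adjoint_rank:
  assumes b1: "\<And>y. Vector_Spaces.linear scale (*) (\<lambda>x. b x y)"
    and b2: "\<And>x. Vector_Spaces.linear scale (*) (b x)"
    and nondeg: "\<And>x. (\<forall>y. b x y = 0) \<longrightarrow> x = 0"
    and L: "Vector_Spaces.linear scale scale L"
    and T: "Vector_Spaces.linear scale scale T"
    and adj: "\<And>x y. b (L x) y = b x (T y)"
    and fin: "finite_rank T"
  shows "finite_rank L"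
    and "dim (range L) \<le> dim (range T)"
    and "\<lbrakk>dim (range L) = dim (range T); Vector_Spaces.linear scale (*) \<phi>\<rbrakk>
          \<Longrightarrow> \<exists>x. \<forall>y. b (L x) y = \<phi> (T y)"
proof -
  interpret vf: vector_space_pair scale "(*) :: 'a \<Rightarrow> 'a \<Rightarrow> 'a"
    by (intro vector_space_pair.intro vector_space_axioms vector_space_field)
  interpret vv: vector_space_pair scale scale
    by (intro vector_space_pair.intro vector_space_axioms)
  interpret L: Vector_Spaces.linear scale scale L by (rule L)
  interpret T: Vector_Spaces.linear scale scale T by (rule T)
  have subL: "subspace (range L)" using L.subspace_image[OF subspace_UNIV] .
  obtain W where W: "finite W" "range T \<subseteq> span W"
    using fin by (auto simp: finite_rank_def)
  obtain Q where Q: "Q \<subseteq> range T" "independent Q" "range T \<subseteq> span Q" "card Q = dim (range T)"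
    by (rule basis_exists)
  have finQ: "finite Q" using independent_span_bound[OF W(1) Q(2)] Q(1) W(2) by blast
  obtain P where P: "P \<subseteq> range L" "independent P" "range L \<subseteq> span P" "card P = dim (range L)"
    by (rule basis_exists)
  have spanP: "span P = range L"
    using P subL by (metis span_minimal subset_antisym)
  have "\<forall>q\<in>Q. \<exists>y. T y = q" using Q(1) by auto
  then obtain pre where pre: "\<And>q. q \<in> Q \<Longrightarrow> T (pre q) = q" by metis
  \<comment> \<open>The embedding, with the dual of the image of \<open>T\<close> identified with that image by the basis \<open>Q\<close>:
    the coordinates of \<open>\<Psi> (L x)\<close> are the values of \<open>b x\<close> on \<open>Q\<close>. Writing them through chosen
    preimages makes \<open>\<Psi>\<close> linear on the whole space.\<close>
  define \<Psi> where "\<Psi> p = (\<Sum>q\<in>Q. scale (b p (pre q)) q)" for p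
  have lin: "Vector_Spaces.linear scale scale \<Psi>"
  proof -
    have "b (x + y) z = b x z + b y z" "b (scale a x) z = a * b x z" for a x y z
      using b1[of z] by (simp_all add: Vector_Spaces.linear_iff)
    then show ?thesis
      unfolding \<Psi>_def Vector_Spaces.linear_iff
      by (simp add: vector_space_axioms scale_left_distrib sum.distrib scale_sum_right)
  qed
  have coord: "c q = 0" if "(\<Sum>q\<in>Q. scale (c q) q) = 0" "q \<in> Q" for c q
    using that Q(2) finQ by (auto simp: independent_explicit_finite_subsets)
  have det: "\<psi> (T y) = \<phi> (T y)"
    if "Vector_Spaces.linear scale (*) \<psi>" "Vector_Spaces.linear scale (*) \<phi>"
      "\<And>q. q \<in> Q \<Longrightarrow> \<psi> q = \<phi> q" for \<psi> \<phi> y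
    by (rule vf.linear_eq_on[OF that(1,2), of _ Q]) (use that(3) Q(3) in auto)
  have zero_lin: "Vector_Spaces.linear scale (*) (\<lambda>x. 0 :: 'a)" by (rule vf.linear_zero)
  have inj0: "p = 0" if p: "p \<in> range L" and p0: "\<Psi> p = 0" for p
  proof -
    obtain x where x: "p = L x" using p by auto
    have "b x q = 0" if q: "q \<in> Q" for q
      using coord[OF p0[unfolded \<Psi>_def] q] adj[of x "pre q"] pre[OF q] x by simp
    then have "b p y = 0" for y
      using det[OF b2 zero_lin, of x y] adj x by simp
    then show "p = 0" using nondeg by blast
  qed
  have inj: "inj_on \<Psi> (span P)"
    unfolding spanP vv.linear_inj_on_iff_eq_0[OF lin subL] using inj0 by auto
  have ind: "independent (\<Psi> ` P)"
    using vv.linear_independent_injective_image[OF lin P(2) inj] .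
  have cardP: "card (\<Psi> ` P) = card P"
    using inj_on_subset[OF inj span_superset] by (rule card_image)
  have spanQ: "\<Psi> p \<in> span Q" for p
    unfolding \<Psi>_def by (intro span_sum span_scale span_base)
  have bound: "finite (\<Psi> ` P) \<and> card (\<Psi> ` P) \<le> card Q"
    using independent_span_bound[OF finQ ind] spanQ by blast
  have finP: "finite P"
    using bound inj_on_subset[OF inj span_superset] finite_imageD by blast
  show "finite_rank L" unfolding finite_rank_def using finP P(3) by blast
  show "dim (range L) \<le> dim (range T)" using bound cardP P(4) Q(4) by simp
  assume eq: "dim (range L) = dim (range T)" and \<phi>: "Vector_Spaces.linear scale (*) \<phi>"
  have "Q \<subseteq> span (\<Psi> ` P)"
  proof
    fix q assume q: "q \<in> Q"
    show "q \<in> span (\<Psi> ` P)"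
    proof (rule ccontr)
      assume nq: "q \<notin> span (\<Psi> ` P)"
      then have "card (insert q (\<Psi> ` P)) \<le> card Q"
        using independent_span_bound[OF finQ independent_insertI[OF nq ind]] spanQ q span_base
        by blast
      moreover have "q \<notin> \<Psi> ` P" using nq span_base by blast
      ultimately show False using bound cardP eq P(4) Q(4) by simp
    qed
  qed
  then have "span Q \<subseteq> \<Psi> ` range L"
    using vv.linear_span_image[OF lin, of P] spanP span_minimal[OF _ subspace_span] by metis
  moreover have "(\<Sum>q\<in>Q. scale (\<phi> q) q) \<in> span Q"
    by (intro span_sum span_scale span_base)
  ultimately obtain x where x: "\<Psi> (L x) = (\<Sum>q\<in>Q. scale (\<phi> q) q)" by auto
  have "b x q = \<phi> q" if q: "q \<in> Q" for q
  proof -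
    have "(\<Sum>q\<in>Q. scale (b (L x) (pre q) - \<phi> q) q) = 0"
      using x by (simp add: \<Psi>_def scale_left_diff_distrib sum_subtractf)
    from coord[OF this q] show ?thesis using adj[of x "pre q"] pre[OF q] by simp
  qed
  then have "b (L x) y = \<phi> (T y)" for y
    using det[OF b2 \<phi>, of x y] adj by simp
  then show "\<exists>x. \<forall>y. b (L x) y = \<phi> (T y)" by blast
qed

section \<open>Tensors and multilinear functionals\<close>

lemma lookup_free_scale: "Poly_Mapping.lookup (free_scale a p) g = a * Poly_Mapping.lookup p g"
  by (simp add: free_scale_def Poly_Mapping.map.rep_eq when_def)

interpretation free: vector_space "free_scale :: 'k::field \<Rightarrow> ('g \<Rightarrow>\<^sub>0 'k) \<Rightarrow> ('g \<Rightarrow>\<^sub>0 'k)"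
  by unfold_locales
    (auto intro!: poly_mapping_eqI simp: lookup_free_scale lookup_add algebra_simps)

definition free_extend :: "('g \<Rightarrow> 'k::field) \<Rightarrow> ('g \<Rightarrow>\<^sub>0 'k) \<Rightarrow> 'k" where
  "free_extend h p = (\<Sum>g\<in>Poly_Mapping.keys p. Poly_Mapping.lookup p g * h g)"

text \<open>Summing over a common superset of the supports is what makes additivity a termwise identity.\<close>
lemma free_extend_superset:
  assumes "finite A" "Poly_Mapping.keys p \<subseteq> A"
  shows "free_extend h p = (\<Sum>g\<in>A. Poly_Mapping.lookup p g * h g)"
  unfolding free_extend_def
  by (rule sum.mono_neutral_left) (use assms in \<open>auto simp: in_keys_iff\<close>)

lemma free_extend_gen [simp]: "free_extend h (free_gen g) = h g"
  by (simp add: free_extend_def free_gen_def)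

lemma linear_free_extend: "Vector_Spaces.linear free_scale (*) (free_extend h)"
proof -
  have "free_extend h (p + q) = free_extend h p + free_extend h q" for p q
  proof -
    let ?A = "Poly_Mapping.keys p \<union> Poly_Mapping.keys q"
    have "Poly_Mapping.keys (p + q) \<subseteq> ?A" by (rule Poly_Mapping.keys_add)
    then show ?thesis
      by (simp add: free_extend_superset[of ?A] lookup_add algebra_simps sum.distrib)
  qed
  moreover have "free_extend h (free_scale a p) = a * free_extend h p" for a p
  proof -
    have "Poly_Mapping.keys (free_scale a p) \<subseteq> Poly_Mapping.keys p"
      by (auto simp: in_keys_iff lookup_free_scale)
    then show ?thesis
      by (simp add: free_extend_superset[of "Poly_Mapping.keys p"] lookup_free_scale
          sum_distrib_left mult.assoc)
  qed
  ultimately show ?thesis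
    by (simp add: Vector_Spaces.linear_iff free.vector_space_axioms vector_space_field)
qed

definition slot_linear ::
  "('k::field \<Rightarrow> 'v::ab_group_add \<Rightarrow> 'v) \<Rightarrow> 'v set \<Rightarrow> ('v \<Rightarrow> 'k) \<Rightarrow> bool" where
  "slot_linear s V h \<longleftrightarrow>
     (\<forall>v\<in>V. \<forall>v'\<in>V. h (v + v') = h v + h v') \<and> (\<forall>a. \<forall>v\<in>V. h (s a v) = a * h v)"

lemma kills_slot_relations_iff:
  assumes "Vector_Spaces.linear free_scale (*) L"
  shows "(\<forall>p\<in>slot_relations s V ins. L p = 0) \<longleftrightarrow> slot_linear s V (\<lambda>v. L (free_gen (ins v)))"
proof -
  interpret L: Vector_Spaces.linear free_scale "(*)" L by (rule assms)
  have "(\<forall>p\<in>slot_relations s V ins. L p = 0) \<longleftrightarrow>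
      (\<forall>v\<in>V. \<forall>v'\<in>V. L (free_gen (ins (v + v')) - free_gen (ins v) - free_gen (ins v')) = 0) \<and>
      (\<forall>a. \<forall>v\<in>V. L (free_gen (ins (s a v)) - free_scale a (free_gen (ins v))) = 0)"
    unfolding slot_relations_def by blast
  then show ?thesis
    unfolding slot_linear_def by (simp add: L.diff L.scale L.add diff_diff_eq)
qed

lemma linear_formal_sum:
  assumes "Vector_Spaces.linear free_scale (*) L"
  shows "L (formal_sum t) = (\<Sum>g\<leftarrow>t. L (free_gen g))"
proof -
  interpret L: Vector_Spaces.linear free_scale "(*)" L by (rule assms)
  show ?thesis by (induction t) (auto simp: formal_sum_def L.add)
qed

text \<open>A vector outside a subspace is detected by a linear functional that kills the subspace, and
  a linear functional on a free vector space is an arbitrary function on the generators. So equality in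
  the tensor product means that no multilinear functional distinguishes the two sides. This form
  is used for every statement about tensors below, as it makes functoriality immediate.\<close>
lemma congruent_modulo_span_iff:
  assumes kills: "\<And>L. Vector_Spaces.linear free_scale (*) L \<Longrightarrow>
      (\<forall>p\<in>R. L p = 0) \<longleftrightarrow> M (\<lambda>g. L (free_gen g))"
  shows "formal_sum t - formal_sum t' \<in> free.span R \<longleftrightarrow>
     (\<forall>h. M h \<longrightarrow> sum_list (map h t) = sum_list (map h t'))" (is "?l \<longleftrightarrow> ?r")
proof
  assume l: ?l
  show ?r
  proof (intro allI impI)
    fix h assume "M h"
    interpret L: Vector_Spaces.linear free_scale "(*)" "free_extend h" by (rule linear_free_extend)
    have "\<forall>p\<in>R. free_extend h p = 0"
      using kills[OF linear_free_extend, of h] \<open>M h\<close> by simp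
    then have "free_extend h (formal_sum t - formal_sum t') = 0"
      using L.eq_0_on_span[of R] l by blast
    then show "sum_list (map h t) = sum_list (map h t')"
      by (simp add: L.diff linear_formal_sum[OF linear_free_extend])
  qed
next
  assume r: ?r
  show ?l
  proof (rule ccontr)
    assume "\<not> ?l"
    then obtain L where L: "Vector_Spaces.linear free_scale (*) L" "\<And>y. y \<in> R \<Longrightarrow> L y = 0"
        "L (formal_sum t - formal_sum t') = 1"
      using free.functional_separates_span by metis
    interpret L: Vector_Spaces.linear free_scale "(*)" L by (rule L)
    have "M (\<lambda>g. L (free_gen g))" using kills[OF L(1)] L(2) by blast
    then show False using r L(3) by (simp add: L.diff linear_formal_sum[OF L(1)])
  qed
qed

lemma tensor_eq_iff:
  "tensor_eq s V s' W t t' \<longleftrightarrow>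
     (\<forall>h. (\<forall>w\<in>W. slot_linear s V (\<lambda>v. h (v, w))) \<and> (\<forall>v\<in>V. slot_linear s' W (\<lambda>w. h (v, w)))
        \<longrightarrow> sum_list (map h t) = sum_list (map h t'))"
  unfolding tensor_eq_def
  by (rule congruent_modulo_span_iff) (simp add: ball_Un kills_slot_relations_iff)

lemma tensor3_eq_iff:
  "tensor3_eq s U s' V s'' W t t' \<longleftrightarrow>
     (\<forall>h. (\<forall>v\<in>V. \<forall>w\<in>W. slot_linear s U (\<lambda>u. h (u, v, w))) \<and>
          (\<forall>u\<in>U. \<forall>w\<in>W. slot_linear s' V (\<lambda>v. h (u, v, w))) \<and>
          (\<forall>u\<in>U. \<forall>v\<in>V. slot_linear s'' W (\<lambda>w. h (u, v, w)))
        \<longrightarrow> sum_list (map h t) = sum_list (map h t'))"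
  unfolding tensor3_eq_def
  by (rule congruent_modulo_span_iff) (simp add: ball_Un kills_slot_relations_iff)

lemma tensor_eq_map:
  assumes "tensor_eq s V s' W t t'"
    and "\<And>v. v \<in> V \<Longrightarrow> f v \<in> V2"
    and "\<And>v v'. v \<in> V \<Longrightarrow> v' \<in> V \<Longrightarrow> f (v + v') = f v + f v'"
    and "\<And>a v. v \<in> V \<Longrightarrow> f (s a v) = s2 a (f v)"
  shows "tensor_eq s2 V2 s' W (map (map_prod f id) t) (map (map_prod f id) t')"
  unfolding tensor_eq_iff
proof (intro allI impI, elim conjE)
  fix h
  assume "\<forall>w\<in>W. slot_linear s2 V2 (\<lambda>v. h (v, w))" "\<forall>v\<in>V2. slot_linear s' W (\<lambda>w. h (v, w))"
  then show "sum_list (map h (map (map_prod f id) t)) = sum_list (map h (map (map_prod f id) t'))"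
    using assms(1)[unfolded tensor_eq_iff, rule_format, of "h \<circ> map_prod f id"]
    by (simp add: assms(2-4) slot_linear_def)
qed

lemma tensor3_eq_map:
  assumes "tensor3_eq s U s' V s'' W t t'"
    and "\<And>u. u \<in> U \<Longrightarrow> f u \<in> U2"
    and "\<And>u u'. u \<in> U \<Longrightarrow> u' \<in> U \<Longrightarrow> f (u + u') = f u + f u'"
    and "\<And>a u. u \<in> U \<Longrightarrow> f (s a u) = s2 a (f u)"
  shows "tensor3_eq s2 U2 s' V s'' W (map (map_prod f id) t) (map (map_prod f id) t')"
  unfolding tensor3_eq_iff
proof (intro allI impI, elim conjE)
  fix h
  assume "\<forall>v\<in>V. \<forall>w\<in>W. slot_linear s2 U2 (\<lambda>u. h (u, v, w))"
    "\<forall>u\<in>U2. \<forall>w\<in>W. slot_linear s' V (\<lambda>v. h (u, v, w))"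
    "\<forall>u\<in>U2. \<forall>v\<in>V. slot_linear s'' W (\<lambda>w. h (u, v, w))"
  then show "sum_list (map h (map (map_prod f id) t)) = sum_list (map h (map (map_prod f id) t'))"
    using assms(1)[unfolded tensor3_eq_iff, rule_format, of "h \<circ> map_prod f id"]
    by (simp add: assms(2-4) slot_linear_def)
qed

lemma tensor_eq_swap:
  "tensor_eq s V s' W t t' \<Longrightarrow> tensor_eq s' W s V (map prod.swap t) (map prod.swap t')"
  unfolding tensor_eq_iff
proof (intro allI impI)
  fix h
  assume *: "\<forall>h. (\<forall>w\<in>W. slot_linear s V (\<lambda>v. h (v, w))) \<and> (\<forall>v\<in>V. slot_linear s' W (\<lambda>w. h (v, w)))
        \<longrightarrow> sum_list (map h t) = sum_list (map h t')"
    and "(\<forall>w\<in>V. slot_linear s' W (\<lambda>v. h (v, w))) \<and> (\<forall>v\<in>W. slot_linear s V (\<lambda>w. h (v, w)))"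
  then show "sum_list (map h (map prod.swap t)) = sum_list (map h (map prod.swap t'))"
    using *[rule_format, of "h \<circ> prod.swap"] by simp
qed

lemma tensor3_eq_reverse:
  assumes "tensor3_eq s U s' V s'' W t t'"
  shows "tensor3_eq s'' W s' V s U (map (\<lambda>(u, v, w). (w, v, u)) t) (map (\<lambda>(u, v, w). (w, v, u)) t')"
  unfolding tensor3_eq_iff
proof (intro allI impI)
  fix h
  assume "(\<forall>v\<in>V. \<forall>w\<in>U. slot_linear s'' W (\<lambda>u. h (u, v, w))) \<and>
       (\<forall>u\<in>W. \<forall>w\<in>U. slot_linear s' V (\<lambda>v. h (u, v, w))) \<and>
       (\<forall>u\<in>W. \<forall>v\<in>V. slot_linear s U (\<lambda>w. h (u, v, w)))"
  then show "sum_list (map h (map (\<lambda>(u, v, w). (w, v, u)) t)) =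
      sum_list (map h (map (\<lambda>(u, v, w). (w, v, u)) t'))"
    using assms[unfolded tensor3_eq_iff, rule_format, of "h \<circ> (\<lambda>(u, v, w). (w, v, u))"]
    by (simp add: o_def)
qed

section \<open>The opposite coalgebra\<close>

text \<open>The opposite coalgebra exchanges left and right: it turns left modules over the dual algebra into
  right ones, and left comodules into right ones, so a theorem on all coalgebras includes its mirror image. The two
  factors may have different types so that the same operation applies to comodule structures.\<close>
definition opposite :: "('x \<Rightarrow> ('a \<times> 'b) list) \<Rightarrow> 'x \<Rightarrow> ('b \<times> 'a) list" where
  "opposite \<Delta> x = map prod.swap (\<Delta> x)"

lemma opposite_opposite [simp]: "opposite (opposite \<Delta>) = \<Delta>"
  by (simp add: opposite_def fun_eq_iff o_def)

lemma left_act_opposite: "left_act scale (opposite \<Delta>) f x = right_act scale \<Delta> x f"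
  by (simp add: left_act_def right_act_def opposite_def o_def split_def)

lemma convolution_opposite: "convolution (opposite \<Delta>) f g = convolution \<Delta> g f"
  by (simp add: convolution_def opposite_def o_def split_def mult.commute fun_eq_iff)

lemma left_dual_morphism_opposite:
  "left_dual_morphism scale (opposite \<Delta>) \<phi> \<longleftrightarrow> right_dual_morphism scale \<Delta> \<phi>"
  by (simp add: left_dual_morphism_def right_dual_morphism_def left_act_opposite
      convolution_opposite)

lemma right_dual_morphism_opposite:
  "right_dual_morphism scale (opposite \<Delta>) \<phi> \<longleftrightarrow> left_dual_morphism scale \<Delta> \<phi>"
  using left_dual_morphism_opposite[of scale "opposite \<Delta>" \<phi>] by simp

lemma right_comodule_opposite:
  assumes "left_comodule scale \<Delta> \<epsilon> s M \<rho>"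
  shows "right_comodule scale (opposite \<Delta>) \<epsilon> s M (opposite \<rho>)"
  unfolding right_comodule_def
proof (intro conjI ballI allI)
  note l = assms[unfolded left_comodule_def]
  show "vector_space s" "module.subspace s M" using l by auto
  show "set (opposite \<rho> m) \<subseteq> M \<times> UNIV" if "m \<in> M" for m
    using l that by (fastforce simp: opposite_def)
  show "tensor_eq s M scale UNIV (opposite \<rho> (m + m')) (opposite \<rho> m @ opposite \<rho> m')"
    if "m \<in> M" "m' \<in> M" for m m'
    using tensor_eq_swap[of scale UNIV s M "\<rho> (m + m')" "\<rho> m @ \<rho> m'"] l that
    by (simp add: opposite_def)
  show "tensor_eq s M scale UNIV (opposite \<rho> (s a m))
      (map (\<lambda>(m0, m1). (s a m0, m1)) (opposite \<rho> m))" if "m \<in> M" for a m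
    using tensor_eq_swap[of scale UNIV s M "\<rho> (s a m)" "map (\<lambda>(m1, m0). (m1, s a m0)) (\<rho> m)"] l that
    by (simp add: opposite_def o_def split_def)
  show "tensor3_eq s M scale UNIV scale UNIV
      [(m00, m01, m1). (m0, m1) \<leftarrow> opposite \<rho> m, (m00, m01) \<leftarrow> opposite \<rho> m0]
      [(m0, m11, m12). (m0, m1) \<leftarrow> opposite \<rho> m, (m11, m12) \<leftarrow> opposite \<Delta> m1]"
    if "m \<in> M" for m
    using tensor3_eq_reverse[of scale UNIV scale UNIV s M
        "[(m1, m01, m00). (m1, m0) \<leftarrow> \<rho> m, (m01, m00) \<leftarrow> \<rho> m0]"
        "[(m11, m12, m0). (m1, m0) \<leftarrow> \<rho> m, (m11, m12) \<leftarrow> \<Delta> m1]"] l that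
    by (simp add: opposite_def o_def split_def prod.swap_def map_concat)
  show "(\<Sum>(m0, m1)\<leftarrow>opposite \<rho> m. s (\<epsilon> m1) m0) = m" if "m \<in> M" for m
    using l that by (simp add: opposite_def o_def split_def)
qed

lemma left_comodule_opposite:
  assumes "right_comodule scale \<Delta> \<epsilon> s M \<rho>"
  shows "left_comodule scale (opposite \<Delta>) \<epsilon> s M (opposite \<rho>)"
  unfolding left_comodule_def
proof (intro conjI ballI allI)
  note r = assms[unfolded right_comodule_def]
  show "vector_space s" "module.subspace s M" using r by auto
  show "set (opposite \<rho> m) \<subseteq> UNIV \<times> M" if "m \<in> M" for m
    using r that by (fastforce simp: opposite_def)
  show "tensor_eq scale UNIV s M (opposite \<rho> (m + m')) (opposite \<rho> m @ opposite \<rho> m')"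
    if "m \<in> M" "m' \<in> M" for m m'
    using tensor_eq_swap[of s M scale UNIV "\<rho> (m + m')" "\<rho> m @ \<rho> m'"] r that
    by (simp add: opposite_def)
  show "tensor_eq scale UNIV s M (opposite \<rho> (s a m))
      (map (\<lambda>(m1, m0). (m1, s a m0)) (opposite \<rho> m))" if "m \<in> M" for a m
    using tensor_eq_swap[of s M scale UNIV "\<rho> (s a m)" "map (\<lambda>(m0, m1). (s a m0, m1)) (\<rho> m)"] r that
    by (simp add: opposite_def o_def split_def)
  show "tensor3_eq scale UNIV scale UNIV s M
      [(m1, m01, m00). (m1, m0) \<leftarrow> opposite \<rho> m, (m01, m00) \<leftarrow> opposite \<rho> m0]
      [(m11, m12, m0). (m1, m0) \<leftarrow> opposite \<rho> m, (m11, m12) \<leftarrow> opposite \<Delta> m1]"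
    if "m \<in> M" for m
    using tensor3_eq_reverse[of s M scale UNIV scale UNIV
        "[(m00, m01, m1). (m0, m1) \<leftarrow> \<rho> m, (m00, m01) \<leftarrow> \<rho> m0]"
        "[(m0, m11, m12). (m0, m1) \<leftarrow> \<rho> m, (m11, m12) \<leftarrow> \<Delta> m1]"] r that
    by (simp add: opposite_def o_def split_def prod.swap_def map_concat)
  show "(\<Sum>(m1, m0)\<leftarrow>opposite \<rho> m. s (\<epsilon> m1) m0) = m" if "m \<in> M" for m
    using r that by (simp add: opposite_def o_def split_def)
qed

lemma left_rational_submodule_opposite:
  fixes scale :: "'k::field \<Rightarrow> 'c::ab_group_add \<Rightarrow> 'c"
  shows "left_rational_submodule scale (opposite \<Delta>) \<epsilon> M \<longleftrightarrow> right_rational_submodule scale \<Delta> \<epsilon> M"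
proof -
  have sw: "(\<Sum>(m0, m1)\<leftarrow>opposite \<rho> m. fun_scale (f m1) m0) = (\<Sum>(m1, m0)\<leftarrow>\<rho> m. fun_scale (f m1) m0)"
    for \<rho> :: "('c \<Rightarrow> 'k) \<Rightarrow> ('c \<times> ('c \<Rightarrow> 'k)) list" and f m
    by (simp add: opposite_def o_def split_def)
  have sw': "(\<Sum>(m1, m0)\<leftarrow>opposite \<rho> m. fun_scale (f m1) m0) = (\<Sum>(m0, m1)\<leftarrow>\<rho> m. fun_scale (f m1) m0)"
    for \<rho> :: "('c \<Rightarrow> 'k) \<Rightarrow> (('c \<Rightarrow> 'k) \<times> 'c) list" and f m
    by (simp add: opposite_def o_def split_def)
  show ?thesis
    unfolding left_rational_submodule_def right_rational_submodule_def convolution_opposite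
    using left_comodule_opposite[of scale "opposite \<Delta>" \<epsilon> fun_scale M, unfolded opposite_opposite]
      right_comodule_opposite[of scale \<Delta> \<epsilon> fun_scale M] sw sw'
    by (intro arg_cong2[where f="(\<and>)"] refl) metis
qed

lemma right_rational_part_opposite:
  "right_rational_part scale \<Delta> \<epsilon> = left_rational_part scale (opposite \<Delta>) \<epsilon>"
  by (simp add: left_rational_part_def right_rational_part_def left_rational_submodule_opposite)

lemma vector_space_fun_scale: "vector_space (fun_scale :: 'k::field \<Rightarrow> ('c \<Rightarrow> 'k) \<Rightarrow> 'c \<Rightarrow> 'k)"
  by unfold_locales (auto simp: fun_scale_def fun_eq_iff algebra_simps)

lemma sum_list_apply: "(\<Sum>g\<leftarrow>t. F g) y = (\<Sum>g\<leftarrow>t. F g y)"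
  for F :: "'g \<Rightarrow> 'c \<Rightarrow> 'k::field"
  by (induction t) auto

lemma (in vector_space) dual_iff_slot_linear: "f \<in> dual scale \<longleftrightarrow> slot_linear scale UNIV f"
  by (simp add: dual_def Vector_Spaces.linear_iff slot_linear_def vector_space_axioms
      vector_space_field)

lemma (in vector_space) dual_sum_list:
  assumes "f \<in> dual scale"
  shows "f (\<Sum>g\<leftarrow>t. F g) = (\<Sum>g\<leftarrow>t. f (F g))"
proof -
  interpret f: Vector_Spaces.linear scale "(*)" f using assms by (simp add: dual_def)
  show ?thesis by (induction t) (auto simp: f.add)
qed

lemma (in vector_space) span_sum_list:
  "(\<And>g. g \<in> set t \<Longrightarrow> F g \<in> span W) \<Longrightarrow> (\<Sum>g\<leftarrow>t. F g) \<in> span W"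
  by (induction t) (auto simp: span_zero span_add)

section \<open>Actions of the dual algebra\<close>

context coalgebra begin

lemma coalgebra_opposite: "coalgebra scale (opposite \<Delta>) \<epsilon>"
proof (intro coalgebra.intro coalgebra_axioms.intro vector_space_axioms)
  show "tensor_eq scale UNIV scale UNIV (opposite \<Delta> (x + y)) (opposite \<Delta> x @ opposite \<Delta> y)" for x y
    using tensor_eq_swap[OF comult_add[of x y]] by (simp add: opposite_def)
  show "tensor_eq scale UNIV scale UNIV (opposite \<Delta> (scale a x))
      (map (\<lambda>(x1, x2). (scale a x1, x2)) (opposite \<Delta> x))" for a x
    unfolding tensor_eq_iff
  proof (intro allI impI)
    fix h :: "'c \<times> 'c \<Rightarrow> 'k"
    assume h: "(\<forall>w\<in>UNIV. slot_linear scale UNIV (\<lambda>v. h (v, w))) \<and>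
        (\<forall>v\<in>UNIV. slot_linear scale UNIV (\<lambda>w. h (v, w)))"
    then have "h (x2, scale a x1) = h (scale a x2, x1)" for x1 x2 by (simp add: slot_linear_def)
    then show "sum_list (map h (opposite \<Delta> (scale a x))) =
        sum_list (map h (map (\<lambda>(x1, x2). (scale a x1, x2)) (opposite \<Delta> x)))"
      using comult_scale[of a x, unfolded tensor_eq_iff, rule_format, of "h \<circ> prod.swap"] h
      by (simp add: opposite_def o_def split_def)
  qed
  show "Vector_Spaces.linear scale (*) \<epsilon>" by (rule counit_linear)
  have sym: "tensor3_eq scale UNIV scale UNIV scale UNIV t' t"
    if "tensor3_eq scale UNIV scale UNIV scale UNIV t t'" for t t' :: "('c \<times> 'c \<times> 'c) list"
    using that unfolding tensor3_eq_iff by metis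
  show "tensor3_eq scale UNIV scale UNIV scale UNIV
      [(x11, x12, x2). (x1, x2) \<leftarrow> opposite \<Delta> x, (x11, x12) \<leftarrow> opposite \<Delta> x1]
      [(x1, x21, x22). (x1, x2) \<leftarrow> opposite \<Delta> x, (x21, x22) \<leftarrow> opposite \<Delta> x2]" for x
    using sym[OF tensor3_eq_reverse[OF coassoc[of x]]]
    by (simp add: opposite_def o_def split_def prod.swap_def map_concat)
  show "(\<Sum>(x1, x2)\<leftarrow>opposite \<Delta> x. scale (\<epsilon> x1) x2) = x"
    "(\<Sum>(x1, x2)\<leftarrow>opposite \<Delta> x. scale (\<epsilon> x2) x1) = x" for x
    using counit_left[of x] counit_right[of x] by (simp_all add: opposite_def o_def split_def)
qed

lemma dual_add: "f \<in> dual scale \<Longrightarrow> f (x + y) = f x + f y"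
  by (simp add: dual_iff_slot_linear slot_linear_def)

lemma dual_scale: "f \<in> dual scale \<Longrightarrow> f (scale a x) = a * f x"
  by (simp add: dual_iff_slot_linear slot_linear_def)

lemma counit_in_dual: "\<epsilon> \<in> dual scale"
  by (simp add: dual_def counit_linear)

lemma dual_separates: "(\<And>\<phi>. \<phi> \<in> dual scale \<Longrightarrow> \<phi> x = \<phi> y) \<Longrightarrow> x = y"
  using functionals_separate_points by (simp add: dual_def)

lemma convolution_in_dual:
  assumes "f \<in> dual scale" "g \<in> dual scale"
  shows "convolution \<Delta> f g \<in> dual scale"
proof -
  have bil: "slot_linear scale UNIV (\<lambda>v. f v * g w)" "slot_linear scale UNIV (\<lambda>w. f v * g w)" for v w
    using assms by (simp_all add: slot_linear_def dual_add dual_scale algebra_simps)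
  have "convolution \<Delta> f g (x + y) = convolution \<Delta> f g x + convolution \<Delta> f g y" for x y
    using comult_add[of x y, unfolded tensor_eq_iff, rule_format, of "\<lambda>(v, w). f v * g w"] bil
    by (simp add: convolution_def)
  moreover have "convolution \<Delta> f g (scale a x) = a * convolution \<Delta> f g x" for a x
    using comult_scale[of a x, unfolded tensor_eq_iff, rule_format, of "\<lambda>(v, w). f v * g w"] bil
    by (simp add: convolution_def o_def split_def dual_scale[OF assms(1)]
        sum_list_const_mult mult.assoc)
  ultimately show ?thesis by (simp add: dual_iff_slot_linear slot_linear_def)
qed

lemma dual_left_act: "\<phi> \<in> dual scale \<Longrightarrow> \<phi> (left_act scale \<Delta> f x) = convolution \<Delta> \<phi> f x"
  by (simp add: left_act_def convolution_def dual_sum_list split_def dual_scale mult.commute)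

lemma dual_right_act: "\<phi> \<in> dual scale \<Longrightarrow> \<phi> (right_act scale \<Delta> x f) = convolution \<Delta> f \<phi> x"
  by (simp add: right_act_def convolution_def dual_sum_list split_def dual_scale)

lemma linear_left_act:
  assumes "f \<in> dual scale"
  shows "Vector_Spaces.linear scale scale (left_act scale \<Delta> f)"
proof -
  have "left_act scale \<Delta> f (x + y) = left_act scale \<Delta> f x + left_act scale \<Delta> f y"
    "left_act scale \<Delta> f (scale a x) = scale a (left_act scale \<Delta> f x)" for a x y
    by (rule dual_separates,
        simp add: dual_left_act dual_add dual_scale convolution_in_dual assms)+
  then show ?thesis by (simp add: Vector_Spaces.linear_iff vector_space_axioms)
qed

lemma linear_right_act:
  assumes "f \<in> dual scale"
  shows "Vector_Spaces.linear scale scale (\<lambda>x. right_act scale \<Delta> x f)"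
proof -
  interpret op: coalgebra scale "opposite \<Delta>" \<epsilon> by (rule coalgebra_opposite)
  show ?thesis using op.linear_left_act[OF assms] by (simp add: left_act_opposite[symmetric])
qed

lemma convolution_counit: "f \<in> dual scale \<Longrightarrow> convolution \<Delta> f \<epsilon> = f"
  using dual_left_act[of f \<epsilon>] counit_right by (auto simp: left_act_def fun_eq_iff)

text \<open>A scalar \<open>a\<close> acts on a module as the element \<open>a \<epsilon>\<close> of the dual algebra, so additivity and
  compatibility with the action already imply linearity.\<close>
lemma left_dual_morphism_scale:
  assumes "left_dual_morphism scale \<Delta> \<alpha>"
  shows "\<alpha> (scale a x) = fun_scale a (\<alpha> x)"
proof -
  let ?f = "fun_scale a \<epsilon>"
  have f: "?f \<in> dual scale"
    using counit_in_dual
    by (simp add: dual_iff_slot_linear slot_linear_def fun_scale_def algebra_simps)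
  have \<alpha>x: "\<alpha> x \<in> dual scale" using assms by (simp add: left_dual_morphism_def)
  have act: "left_act scale \<Delta> ?f x = scale a x"
  proof (rule dual_separates)
    fix \<phi> assume \<phi>: "\<phi> \<in> dual scale"
    have "convolution \<Delta> \<phi> ?f x = a * convolution \<Delta> \<phi> \<epsilon> x"
      by (simp add: convolution_def fun_scale_def sum_list_const_mult[symmetric] split_def
          algebra_simps)
    then show "\<phi> (left_act scale \<Delta> ?f x) = \<phi> (scale a x)"
      using \<phi> by (simp add: dual_left_act convolution_counit dual_scale)
  qed
  have "convolution \<Delta> ?f (\<alpha> x) y = a * \<alpha> x y" for y
  proof -
    have "(\<Sum>(y1, y2)\<leftarrow>\<Delta> y. \<epsilon> y1 * \<alpha> x y2) = \<alpha> x (\<Sum>(y1, y2)\<leftarrow>\<Delta> y. scale (\<epsilon> y1) y2)"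
      using \<alpha>x by (simp add: dual_sum_list split_def dual_scale)
    then show ?thesis
      using counit_left[of y]
      by (simp add: convolution_def fun_scale_def sum_list_const_mult split_def
          mult.assoc)
  qed
  moreover have "\<alpha> (scale a x) = convolution \<Delta> ?f (\<alpha> x)"
    using assms f act by (metis left_dual_morphism_def)
  ultimately show ?thesis by (simp add: fun_scale_def fun_eq_iff)
qed

end

section \<open>Rational submodules\<close>

context coalgebra begin

text \<open>With \<open>\<rho>(m) = \<Sum> m0 \<otimes> m1\<close>, rationality says \<open>f m = \<Sum> f(m1) m0\<close> for all \<open>f\<close>. Evaluated at
  \<open>y\<close>, this is \<open>f(m \<cdot> y) = f(\<Sum> m0(y) m1)\<close>, so \<open>m \<cdot> y\<close> lies in the span of the finitely many
  \<open>m1\<close>.\<close>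
lemma left_act_rational:
  assumes "left_rational_submodule scale \<Delta> \<epsilon> M" "m \<in> M"
  shows "finite_rank (left_act scale \<Delta> m)"
proof -
  obtain \<rho> where \<rho>: "\<And>f. f \<in> dual scale \<Longrightarrow>
      convolution \<Delta> f m = (\<Sum>(m0, m1)\<leftarrow>\<rho> m. fun_scale (f m1) m0)"
    using assms by (auto simp: left_rational_submodule_def)
  have "left_act scale \<Delta> m y = (\<Sum>(m0, m1)\<leftarrow>\<rho> m. scale (m0 y) m1)" for y
  proof (rule dual_separates)
    fix \<phi> assume \<phi>: "\<phi> \<in> dual scale"
    then show "\<phi> (left_act scale \<Delta> m y) = \<phi> (\<Sum>(m0, m1)\<leftarrow>\<rho> m. scale (m0 y) m1)"
      by (simp add: dual_left_act \<rho> sum_list_apply split_def fun_scale_def dual_sum_list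
          dual_scale mult.commute)
  qed
  then have "left_act scale \<Delta> m y \<in> span (snd ` set (\<rho> m))" for y
    by (simp add: split_def) (rule span_sum_list, rule span_scale, rule span_base, simp)
  then show ?thesis unfolding finite_rank_def by blast
qed

text \<open>The comodule structure on the image is \<open>\<Delta>\<close> transported along \<open>\<alpha>\<close>; it induces the multiplication
  action because \<open>f \<alpha>(x) = \<alpha>(f \<cdot> x) = \<Sum> f(x2) \<alpha>(x1)\<close>.\<close>
lemma range_left_rational:
  assumes \<alpha>: "left_dual_morphism scale \<Delta> \<alpha>" and inj: "inj \<alpha>"
  shows "left_rational_submodule scale \<Delta> \<epsilon> (range \<alpha>)"
proof -
  interpret funs: vector_space "fun_scale :: 'k \<Rightarrow> ('c \<Rightarrow> 'k) \<Rightarrow> 'c \<Rightarrow> 'k"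
    by (rule vector_space_fun_scale)
  have add: "\<alpha> (x + y) = \<alpha> x + \<alpha> y" and in_dual: "\<alpha> x \<in> dual scale"
    and act: "f \<in> dual scale \<Longrightarrow> \<alpha> (left_act scale \<Delta> f x) = convolution \<Delta> f (\<alpha> x)" for x y f
    using \<alpha> by (auto simp: left_dual_morphism_def)
  have scl: "\<alpha> (scale a x) = fun_scale a (\<alpha> x)" for a x
    by (rule left_dual_morphism_scale[OF \<alpha>])
  have zero: "\<alpha> 0 = 0" using add[of 0 0] by simp
  have \<alpha>_sum: "\<alpha> (\<Sum>g\<leftarrow>t. F g) = (\<Sum>g\<leftarrow>t. \<alpha> (F g))" for F and t :: "('c \<times> 'c) list"
    by (induction t) (auto simp: add zero)
  have sub: "funs.subspace (range \<alpha>)"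
    unfolding funs.subspace_def
    by (auto simp: image_iff) (metis zero, metis add, metis scl)
  define \<rho> where "\<rho> m = map (map_prod \<alpha> id) (\<Delta> (inv \<alpha> m))" for m
  have \<rho>: "\<rho> (\<alpha> x) = map (map_prod \<alpha> id) (\<Delta> x)" for x
    by (simp add: \<rho>_def inj)
  note push = tensor_eq_map[where f = \<alpha> and s = scale and V = UNIV and ?V2.0 = "range \<alpha>"
      and ?s2.0 = fun_scale, OF _ _ add scl]
  note push3 = tensor3_eq_map[where f = \<alpha> and s = scale and U = UNIV and ?U2.0 = "range \<alpha>"
      and ?s2.0 = fun_scale, OF _ _ add scl]
  have "right_comodule scale \<Delta> \<epsilon> fun_scale (range \<alpha>) \<rho>"
    unfolding right_comodule_def
  proof (intro conjI ballI allI vector_space_fun_scale sub; elim rangeE; hypsubst)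
    fix x y a
    show "set (\<rho> (\<alpha> x)) \<subseteq> range \<alpha> \<times> UNIV" by (auto simp: \<rho>)
    show "tensor_eq fun_scale (range \<alpha>) scale UNIV (\<rho> (\<alpha> x + \<alpha> y)) (\<rho> (\<alpha> x) @ \<rho> (\<alpha> y))"
      using push[OF comult_add[of x y]] by (simp add: \<rho> flip: add)
    show "tensor_eq fun_scale (range \<alpha>) scale UNIV (\<rho> (fun_scale a (\<alpha> x)))
        (map (\<lambda>(m0, m1). (fun_scale a m0, m1)) (\<rho> (\<alpha> x)))"
      using push[OF comult_scale[of a x]]
      by (simp add: \<rho> scl[symmetric] o_def split_def map_prod_def)
    show "tensor3_eq fun_scale (range \<alpha>) scale UNIV scale UNIV
        [(m00, m01, m1). (m0, m1) \<leftarrow> \<rho> (\<alpha> x), (m00, m01) \<leftarrow> \<rho> m0]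
        [(m0, m11, m12). (m0, m1) \<leftarrow> \<rho> (\<alpha> x), (m11, m12) \<leftarrow> \<Delta> m1]"
      using push3[OF coassoc[of x]]
      by (simp add: \<rho> o_def split_def map_prod_def map_concat)
    have "(\<Sum>(m0, m1)\<leftarrow>\<rho> (\<alpha> x). fun_scale (\<epsilon> m1) m0) = \<alpha> (\<Sum>(x1, x2)\<leftarrow>\<Delta> x. scale (\<epsilon> x2) x1)"
      by (simp add: \<rho> o_def split_def map_prod_def scl \<alpha>_sum)
    then show "(\<Sum>(m0, m1)\<leftarrow>\<rho> (\<alpha> x). fun_scale (\<epsilon> m1) m0) = \<alpha> x"
      by (simp add: counit_right)
  qed
  moreover have "convolution \<Delta> f m = (\<Sum>(m0, m1)\<leftarrow>\<rho> m. fun_scale (f m1) m0)"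
    if "f \<in> dual scale" "m \<in> range \<alpha>" for f m
    using that by (auto simp: act[symmetric] left_act_def \<rho> \<alpha>_sum o_def split_def map_prod_def scl)
  moreover have "convolution \<Delta> f m \<in> range \<alpha>" if "f \<in> dual scale" "m \<in> range \<alpha>" for f m
    using that by (auto simp: act[symmetric])
  ultimately show ?thesis
    unfolding left_rational_submodule_def using in_dual sub by blast
qed

text \<open>A functional \<open>\<phi>\<close> takes the value \<open>\<alpha>(\<phi> \<cdot> x)(y)\<close> on both sides: on the left because \<open>\<alpha>\<close> is a
  morphism, \<open>\<phi>(\<alpha>(x) \<cdot> y) = (\<phi> \<alpha>(x))(y)\<close>, and on the right by linearity,
  \<open>\<Sum> \<phi>(x2) \<alpha>(x1)(y)\<close>.\<close>
lemma left_right_act_eq: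
  assumes \<alpha>: "left_dual_morphism scale \<Delta> \<alpha>"
  shows "left_act scale \<Delta> (\<alpha> x) y = right_act scale \<Delta> x (\<lambda>z. \<alpha> z y)"
proof (rule dual_separates)
  fix \<phi> assume \<phi>: "\<phi> \<in> dual scale"
  have "(\<lambda>z. \<alpha> z y) \<in> dual scale"
    using \<alpha> left_dual_morphism_scale[OF \<alpha>]
    by (simp add: dual_iff_slot_linear slot_linear_def left_dual_morphism_def fun_scale_def)
  from dual_left_act[OF this, of \<phi> x]
  have "\<alpha> (left_act scale \<Delta> \<phi> x) y = (\<Sum>(x1, x2)\<leftarrow>\<Delta> x. \<alpha> x1 y * \<phi> x2)"
    by (simp add: convolution_def)
  then show "\<phi> (left_act scale \<Delta> (\<alpha> x) y) = \<phi> (right_act scale \<Delta> x (\<lambda>z. \<alpha> z y))"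
    using \<phi> \<alpha> by (simp add: dual_left_act dual_right_act left_dual_morphism_def)
      (simp add: convolution_def)
qed

text \<open>\<open>\<beta>(x \<cdot> f)(y) = \<alpha>(y)(x \<cdot> f) = (f \<alpha>(y))(x) = \<alpha>(f \<cdot> y)(x) = \<beta>(x)(f \<cdot> y) = (\<beta>(x) f)(y)\<close>.\<close>
lemma transpose_right_dual_morphism:
  assumes \<alpha>: "left_dual_morphism scale \<Delta> \<alpha>" and \<beta>: "\<And>x y. \<beta> x y = \<alpha> y x"
  shows "right_dual_morphism scale \<Delta> \<beta>"
proof -
  have add: "\<alpha> (x + y) = \<alpha> x + \<alpha> y" and in_dual: "\<alpha> x \<in> dual scale"
    and act: "f \<in> dual scale \<Longrightarrow> \<alpha> (left_act scale \<Delta> f x) = convolution \<Delta> f (\<alpha> x)" for x y f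
    using \<alpha> by (auto simp: left_dual_morphism_def)
  have \<beta>_dual: "\<beta> x \<in> dual scale" for x
    by (simp add: dual_iff_slot_linear slot_linear_def \<beta> add left_dual_morphism_scale[OF \<alpha>]
        fun_scale_def)
  have "\<beta> (right_act scale \<Delta> x f) y = convolution \<Delta> (\<beta> x) f y" if f: "f \<in> dual scale" for f x y
    using dual_right_act[OF in_dual[of y], of x f] act[OF f, of y]
      dual_left_act[OF \<beta>_dual[of x], of f y]
    by (simp add: \<beta>)
  then show ?thesis
    using \<beta>_dual by (auto simp: right_dual_morphism_def fun_eq_iff \<beta> dual_add[OF in_dual])
qed

section \<open>The rational part of a co-Frobenius coalgebra\<close>

text \<open>Here \<open>adjoint_rank\<close> is applied to the form \<open>\<alpha> x y\<close>, for which the two actions of \<open>e\<close> are adjoint.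
  In the case of equal ranks the functional to represent is the counit, as \<open>\<epsilon>(y \<cdot> e) = e y\<close>.\<close>
lemma left_dual_morphism_rank:
  assumes \<alpha>: "left_dual_morphism scale \<Delta> \<alpha>" and inj: "inj \<alpha>" and e: "e \<in> dual scale"
    and fin: "finite_rank (\<lambda>y. right_act scale \<Delta> y e)"
  shows "finite_rank (left_act scale \<Delta> e)"
    and "dim (range (left_act scale \<Delta> e)) \<le> dim (range (\<lambda>y. right_act scale \<Delta> y e))"
    and "dim (range (left_act scale \<Delta> e)) = dim (range (\<lambda>y. right_act scale \<Delta> y e)) \<Longrightarrow> e \<in> range \<alpha>"
proof -
  have in_dual: "\<alpha> x \<in> dual scale" for x using \<alpha> by (simp add: left_dual_morphism_def)
  have b2: "Vector_Spaces.linear scale (*) (\<alpha> x)" for x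
    using in_dual by (simp add: dual_def)
  have add: "\<alpha> (x + y) = \<alpha> x + \<alpha> y" for x y
    using \<alpha> by (auto simp: left_dual_morphism_def)
  have b1: "Vector_Spaces.linear scale (*) (\<lambda>x. \<alpha> x y)" for y
    using transpose_right_dual_morphism[OF \<alpha>, of "\<lambda>y x. \<alpha> x y"]
    by (simp add: right_dual_morphism_def dual_def)
  have zero: "\<alpha> 0 = 0" using add[of 0 0] by simp
  have nondeg: "(\<forall>y. \<alpha> x y = 0) \<longrightarrow> x = 0" for x
    using injD[OF inj, of x 0] zero by (auto simp: fun_eq_iff)
  have adj: "\<alpha> (left_act scale \<Delta> e x) y = \<alpha> x (right_act scale \<Delta> y e)" for x y
    using \<alpha> e dual_right_act[OF in_dual, of x y e] by (simp add: left_dual_morphism_def)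
  note rank = adjoint_rank[of \<alpha>, OF b1 b2 nondeg linear_left_act[OF e] linear_right_act[OF e] adj fin]
  show "finite_rank (left_act scale \<Delta> e)" by (rule rank(1))
  show "dim (range (left_act scale \<Delta> e)) \<le> dim (range (\<lambda>y. right_act scale \<Delta> y e))"
    by (rule rank(2))
  assume "dim (range (left_act scale \<Delta> e)) = dim (range (\<lambda>y. right_act scale \<Delta> y e))"
  from rank(3)[OF this counit_linear] obtain x where
    x: "\<And>y. \<alpha> (left_act scale \<Delta> e x) y = \<epsilon> (right_act scale \<Delta> y e)" by blast
  have "\<alpha> (left_act scale \<Delta> e x) = e"
    using x dual_right_act[OF counit_in_dual] convolution_counit[OF e] by (simp add: fun_eq_iff)
  then show "e \<in> range \<alpha>" by (metis rangeI)
qed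

text \<open>An injective morphism of left modules bounds the rank of the left action by that of the right
  action, and an injective morphism of right modules gives the opposite bound.\<close>
lemma co_frobenius_rank:
  assumes "co_frobenius scale \<Delta>" and e: "e \<in> dual scale"
  shows "finite_rank (left_act scale \<Delta> e) \<longleftrightarrow> finite_rank (\<lambda>y. right_act scale \<Delta> y e)"
    and "finite_rank (left_act scale \<Delta> e) \<Longrightarrow>
      dim (range (left_act scale \<Delta> e)) = dim (range (\<lambda>y. right_act scale \<Delta> y e))"
proof -
  interpret op: coalgebra scale "opposite \<Delta>" \<epsilon> by (rule coalgebra_opposite)
  obtain \<phi> where \<phi>: "left_dual_morphism scale \<Delta> \<phi>" "inj \<phi>"
    using assms(1) by (auto simp: co_frobenius_def left_co_frobenius_def)
  obtain \<gamma> where \<gamma>: "left_dual_morphism scale (opposite \<Delta>) \<gamma>" "inj \<gamma>"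
    using assms(1)
    by (auto simp: co_frobenius_def right_co_frobenius_def left_dual_morphism_opposite)
  have left_op: "left_act scale (opposite \<Delta>) e = (\<lambda>y. right_act scale \<Delta> y e)"
    by (simp add: left_act_opposite fun_eq_iff)
  have right_op: "(\<lambda>y. right_act scale (opposite \<Delta>) y e) = left_act scale \<Delta> e"
    using left_act_opposite[of scale "opposite \<Delta>" e] by (simp add: fun_eq_iff)
  note l = left_dual_morphism_rank(1,2)[OF \<phi> e]
  note r = op.left_dual_morphism_rank(1,2)[OF \<gamma> e, unfolded left_op right_op]
  show "finite_rank (left_act scale \<Delta> e) \<longleftrightarrow> finite_rank (\<lambda>y. right_act scale \<Delta> y e)"
    using l(1) r(1) by blast
  show "dim (range (left_act scale \<Delta> e)) = dim (range (\<lambda>y. right_act scale \<Delta> y e))"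
    if "finite_rank (left_act scale \<Delta> e)"
    using l r that by (blast intro: antisym)
qed

lemma range_eq_finite_rank:
  assumes co: "co_frobenius scale \<Delta>" and \<alpha>: "left_dual_morphism scale \<Delta> \<alpha>" "inj \<alpha>"
  shows "range \<alpha> = {e \<in> dual scale. finite_rank (left_act scale \<Delta> e)}"
proof (intro subset_antisym subsetI)
  fix e assume "e \<in> range \<alpha>"
  then show "e \<in> {e \<in> dual scale. finite_rank (left_act scale \<Delta> e)}"
    using left_act_rational[OF range_left_rational[OF \<alpha>]] \<alpha>(1)
    by (auto simp: left_dual_morphism_def)
next
  fix e assume "e \<in> {e \<in> dual scale. finite_rank (left_act scale \<Delta> e)}"
  then show "e \<in> range \<alpha>"
    using left_dual_morphism_rank(3)[OF \<alpha>] co_frobenius_rank[OF co] by blast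
qed

lemma left_rational_part_eq_range:
  assumes "co_frobenius scale \<Delta>" "left_dual_morphism scale \<Delta> \<alpha>" "inj \<alpha>"
  shows "left_rational_part scale \<Delta> \<epsilon> = range \<alpha>"
  unfolding left_rational_part_def
proof (rule Greatest_equality)
  show "left_rational_submodule scale \<Delta> \<epsilon> (range \<alpha>)"
    by (rule range_left_rational[OF assms(2,3)])
  show "M \<le> range \<alpha>" if "left_rational_submodule scale \<Delta> \<epsilon> M" for M
    unfolding range_eq_finite_rank[OF assms]
    using that left_act_rational[OF that] by (auto simp: left_rational_submodule_def)
qed

lemma co_frobenius_opposite: "co_frobenius scale (opposite \<Delta>) \<longleftrightarrow> co_frobenius scale \<Delta>"
  by (auto simp: co_frobenius_def left_co_frobenius_def right_co_frobenius_def
      left_dual_morphism_opposite right_dual_morphism_opposite)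

text \<open>The operator \<open>w \<mapsto> w \<cdot> \<beta>(z) = \<alpha>(w) \<cdot> z\<close> has finite rank, as its values lie in the span of the
  left factors of \<open>\<Delta> z\<close>. So \<open>\<beta>(z)\<close> is some \<open>\<alpha>(p)\<close>, and then \<open>\<beta>(z)(x) = \<beta>(x)(p)\<close>: the element
  \<open>\<beta>(x)\<close> determines \<open>\<beta>(z)(x) = \<alpha>(x)(z)\<close> for all \<open>z\<close>, that is \<open>\<alpha>(x)\<close>.\<close>
lemma transpose_inj:
  assumes co: "co_frobenius scale \<Delta>" and \<alpha>: "left_dual_morphism scale \<Delta> \<alpha>" "inj \<alpha>"
    and \<beta>: "\<And>x y. \<beta> x y = \<alpha> y x"
  shows "inj \<beta>"
proof (rule injI)
  fix x y assume eq: "\<beta> x = \<beta> y"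
  have r: "right_dual_morphism scale \<Delta> \<beta>" by (rule transpose_right_dual_morphism[OF \<alpha>(1) \<beta>])
  have "\<beta> z \<in> range \<alpha>" for z
  proof -
    have \<beta>z: "\<beta> z \<in> dual scale" using r by (simp add: right_dual_morphism_def)
    have "right_act scale \<Delta> w (\<beta> z) = left_act scale \<Delta> (\<alpha> w) z" for w
      using left_right_act_eq[OF \<alpha>(1), of w z] by (simp add: \<beta>[abs_def])
    then have "right_act scale \<Delta> w (\<beta> z) \<in> span (fst ` set (\<Delta> z))" for w
      by (simp add: left_act_def split_def) (rule span_sum_list, rule span_scale, rule span_base, simp)
    then have "finite_rank (\<lambda>w. right_act scale \<Delta> w (\<beta> z))" unfolding finite_rank_def by blast
    then show ?thesis
      using range_eq_finite_rank[OF co \<alpha>] co_frobenius_rank(1)[OF co \<beta>z] \<beta>z by blast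
  qed
  then have "\<beta> z x = \<beta> z y" for z
    using eq \<beta> by (metis imageE)
  then have "\<alpha> x z = \<alpha> y z" for z using \<beta> by simp
  then show "x = y" using \<alpha>(2) by (auto simp: fun_eq_iff inj_def)
qed

lemma Rat_eq_range:
  assumes co: "co_frobenius scale \<Delta>" and \<alpha>: "left_dual_morphism scale \<Delta> \<alpha>" "inj \<alpha>"
    and \<beta>: "\<And>x y. \<beta> x y = \<alpha> y x"
  shows "Rat scale \<Delta> \<epsilon> = range \<alpha>" and "Rat scale \<Delta> \<epsilon> = range \<beta>"
proof -
  interpret op: coalgebra scale "opposite \<Delta>" \<epsilon> by (rule coalgebra_opposite)
  have r: "left_dual_morphism scale (opposite \<Delta>) \<beta>"
    using transpose_right_dual_morphism[OF \<alpha>(1) \<beta>] by (simp add: left_dual_morphism_opposite)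
  have co': "co_frobenius scale (opposite \<Delta>)" using co by (simp add: co_frobenius_opposite)
  note \<beta>' = co' r transpose_inj[OF co \<alpha> \<beta>]
  have "range \<beta> = {e \<in> dual scale. finite_rank (\<lambda>y. right_act scale \<Delta> y e)}"
    using op.range_eq_finite_rank[OF \<beta>']
    by (simp add: left_act_opposite[abs_def])
  then have eq: "range \<beta> = range \<alpha>"
    unfolding range_eq_finite_rank[OF co \<alpha>] using co_frobenius_rank(1)[OF co] by blast
  have "right_rational_part scale \<Delta> \<epsilon> = range \<beta>"
    using op.left_rational_part_eq_range[OF \<beta>'] by (simp add: right_rational_part_opposite)
  then show "Rat scale \<Delta> \<epsilon> = range \<alpha>" "Rat scale \<Delta> \<epsilon> = range \<beta>"
    unfolding Rat_def using left_rational_part_eq_range[OF co \<alpha>] eq by auto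
qed

end

theorem proposition3p1:
  fixes scale :: "'k::field \<Rightarrow> 'c::ab_group_add \<Rightarrow> 'c"
    and \<Delta> :: "'c \<Rightarrow> ('c \<times> 'c) list"
    and \<epsilon> :: "'c \<Rightarrow> 'k"
    and \<alpha> \<beta> :: "'c \<Rightarrow> 'c \<Rightarrow> 'k"
  assumes "coalgebra scale \<Delta> \<epsilon>"
    and "co_frobenius scale \<Delta>"
    and "left_dual_morphism scale \<Delta> \<alpha>" and "inj \<alpha>"
    and "\<And>x y. \<beta> x y = \<alpha> y x"
  shows "\<forall>x y. transferred_mult \<Delta> (Rat scale \<Delta> \<epsilon>) \<alpha> x y
             = transferred_mult \<Delta> (Rat scale \<Delta> \<epsilon>) \<beta> x y"
proof (intro allI)
  fix x y
  interpret coalgebra scale \<Delta> \<epsilon> by (rule assms(1))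
  have \<beta>: "right_dual_morphism scale \<Delta> \<beta>" "inj \<beta>"
    using transpose_right_dual_morphism[OF assms(3,5)] transpose_inj[OF assms(2-5)] by auto
  have "convolution \<Delta> (\<alpha> x) (\<alpha> y) = \<alpha> (left_act scale \<Delta> (\<alpha> x) y)"
    using assms(3) by (simp add: left_dual_morphism_def)
  then have "transferred_mult \<Delta> (Rat scale \<Delta> \<epsilon>) \<alpha> x y = left_act scale \<Delta> (\<alpha> x) y"
    by (simp add: transferred_mult_def inverse_on_def Rat_eq_range(1)[OF assms(2-5)] assms(4))
  also have "\<dots> = right_act scale \<Delta> x (\<beta> y)"
    using left_right_act_eq[OF assms(3), of x y] by (simp add: assms(5)[abs_def])
  also have "\<dots> = transferred_mult \<Delta> (Rat scale \<Delta> \<epsilon>) \<beta> x y"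
  proof -
    have "convolution \<Delta> (\<beta> x) (\<beta> y) = \<beta> (right_act scale \<Delta> x (\<beta> y))"
      using \<beta>(1) by (simp add: right_dual_morphism_def)
    then show ?thesis
      by (simp add: transferred_mult_def inverse_on_def Rat_eq_range(2)[OF assms(2-5)] \<beta>(2))
  qed
  finally show "transferred_mult \<Delta> (Rat scale \<Delta> \<epsilon>) \<alpha> x y
      = transferred_mult \<Delta> (Rat scale \<Delta> \<epsilon>) \<beta> x y" .
qed

end
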